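(* For every finite connected graph $G=(V,E)$ there is a random strict ranking (random linear order) $\Pi$ of $V$ whose first-ranked vertex is uniformly distributed on $V$ and whose majority-margin matrix satisfies, for all $a,b\in V$, $$\Pr_\Pi(a\succ b)-\Pr_\Pi(b\succ a)=\frac{2A_G(a,b)}{|V|}.$$ The optimal strategies of the first-passage location game on $G$, i.e. the elements of $\mathcal O(G)$, are precisely the maximal lotteries of this ranking distribution.
   Context: Walk: on a finite connected graph $G=(V,E)$ the constant-speed walk waits at each nonisolated vertex an exponential time of mean one and then jumps to a uniformly random neighbor; on the one-vertex graph it stays put. Payoffs: for independent walks started at $a,b\in V$, let $\tau_z^{(a)},\tau_z^{(b)}$ be the first hitting times of $z\in V$ (equal to $0$ if the start is $z$), and set $$q_z(a,b)=\Pr(\tau_z^{(a)}<\tau_z^{(b)})+\tfrac12\Pr(\tau_z^{(a)}=\tau_z^{(b)}),\qquad U_G(a,b)=\sum_{z\in V}q_z(a,b),\qquad A_G(a,b)=U_G(a,b)-\tfrac{|V|}{2}.$$ Co-location is permitted, with the two walks independent given their common start. Optimal strategies: $$\mathcal O(G)=\Bigl\{\mu\in\mathcal P(V):\ \sum_{a\in V}\mu(a)A_G(a,b)\ge 0\ \text{ for every } b\in V\Bigr\},$$ where $\mathcal P(V)$ is the set of probability measures on $V$. For a random strict ranking $\Pi$ of $V$, $a\succ b$ means that $a$ is ranked ahead of $b$; its majority-margin matrix is $M(a,b)=\Pr_\Pi(a\succ b)-\Pr_\Pi(b\succ a)$ (with $M(a,a)=0$). A maximal lottery of $\Pi$ is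 a probability measure $\mu$ on $V$ with $\sum_{a}\mu(a)M(a,b)\ge0$ for every $b\in V$. *)

theory Defs
  imports "HOL-Probability.Probability" "Graph_Theory.Graph_Theory"
begin

section \<open>The constant-speed random walk\<close>

text \<open>
  A finite connected simple graph is a \<^term>\<open>G :: ('a, 'b) pre_digraph\<close> with \<open>graph G\<close> (finite,
  symmetric, no loops, no parallel arcs) and \<open>Digraph_Component.connected G\<close>; the latter includes
  \<open>verts G \<noteq> {}\<close>.
\<close>

definition neighbours :: "('a, 'b) pre_digraph \<Rightarrow> 'a \<Rightarrow> 'a set" where
  "neighbours G v = {w. v \<rightarrow>\<^bsub>G\<^esub> w}"

text \<open>
  At an isolated vertex the only target of a move is the vertex itself, so the walk stays put there.
\<close>

definition targets :: "('a, 'b) pre_digraph \<Rightarrow> 'a \<Rightarrow> 'a set" where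
  "targets G v = (if neighbours G v = {} then {v} else neighbours G v)"

text \<open>
  The exponential law of mean one. The null set of nonpositive times is removed from the space, so
  that every sample path below is a genuine jump path and hitting times are measurable everywhere.
\<close>

definition holding_time :: "real measure" where
  "holding_time = restrict_space (density lborel (exponential_density 1)) {0<..}"

text \<open>
  A sample point consists of the holding times \<open>e k\<close> and of targets \<open>c (n, v)\<close>, all independent:
  \<open>c (n, v)\<close> is a uniformly random neighbour of \<open>v\<close>, and it is the vertex to which the \<open>n\<close>-th jump
  leads if that jump is made from \<open>v\<close>. As fresh targets are used for each \<open>n\<close>, the sequence of
  visited vertices is a Markov chain with uniform jumps to neighbours.
\<close>

type_synonym 'a walk_sample = "(nat \<Rightarrow> real) \<times> (nat \<times> 'a \<Rightarrow> 'a)"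

definition walk_space :: "('a, 'b) pre_digraph \<Rightarrow> 'a walk_sample measure" where
  "walk_space G =
     (\<Pi>\<^sub>M k\<in>(UNIV :: nat set). holding_time) \<Otimes>\<^sub>M
     (\<Pi>\<^sub>M i\<in>(UNIV :: nat set) \<times> verts G. uniform_count_measure (targets G (snd i)))"

primrec jump_chain :: "'a \<Rightarrow> (nat \<times> 'a \<Rightarrow> 'a) \<Rightarrow> nat \<Rightarrow> 'a" where
  "jump_chain a c 0 = a"
| "jump_chain a c (Suc n) = c (n, jump_chain a c n)"

text \<open>
  The number of jumps made up to and including time \<open>t\<close>; jump \<open>n\<close> (counted from \<open>0\<close>) happens at time
  \<open>e 0 + \<dots> + e n\<close>. The set is finite for all \<open>t\<close> almost surely.
\<close>

definition jump_count :: "(nat \<Rightarrow> real) \<Rightarrow> real \<Rightarrow> nat" where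
  "jump_count e t = card {n. (\<Sum>k\<le>n. e k) \<le> t}"

definition walk_at :: "'a \<Rightarrow> 'a walk_sample \<Rightarrow> real \<Rightarrow> 'a" where
  "walk_at a \<omega> t = jump_chain a (snd \<omega>) (jump_count (fst \<omega>) t)"

definition hitting_time :: "'a \<Rightarrow> 'a \<Rightarrow> 'a walk_sample \<Rightarrow> ereal" where
  "hitting_time a z \<omega> = (INF t\<in>{t. 0 \<le> t \<and> walk_at a \<omega> t = z}. ereal t)"


section \<open>The first-passage location game\<close>

text \<open>
  The two walks live on the product of two copies of the walk space, hence are independent, also
  when \<open>a = b\<close>.
\<close>

definition first_passage_prob :: "('a, 'b) pre_digraph \<Rightarrow> 'a \<Rightarrow> 'a \<Rightarrow> 'a \<Rightarrow> real" where
  "first_passage_prob G z a b =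
     \<P>(\<omega> in walk_space G \<Otimes>\<^sub>M walk_space G. hitting_time a z (fst \<omega>) < hitting_time b z (snd \<omega>)) +
     1 / 2 *
     \<P>(\<omega> in walk_space G \<Otimes>\<^sub>M walk_space G. hitting_time a z (fst \<omega>) = hitting_time b z (snd \<omega>))"

definition payoff :: "('a, 'b) pre_digraph \<Rightarrow> 'a \<Rightarrow> 'a \<Rightarrow> real" where
  "payoff G a b = (\<Sum>z\<in>verts G. first_passage_prob G z a b)"

definition advantage :: "('a, 'b) pre_digraph \<Rightarrow> 'a \<Rightarrow> 'a \<Rightarrow> real" where
  "advantage G a b = payoff G a b - real (card (verts G)) / 2"

text \<open>Probability measures on a finite set \<open>V\<close> are probability mass functions supported in \<open>V\<close>.\<close>

definition optimal_strategies :: "('a, 'b) pre_digraph \<Rightarrow> 'a pmf set" where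
  "optimal_strategies G =
     {\<mu>. set_pmf \<mu> \<subseteq> verts G \<and>
         (\<forall>b\<in>verts G. (\<Sum>a\<in>verts G. pmf \<mu> a * advantage G a b) \<ge> 0)}"


section \<open>Random rankings and maximal lotteries\<close>

text \<open>
  A strict ranking of \<open>V\<close> is a strict linear order \<open>r\<close> on \<open>V\<close>; \<open>(a, b) \<in> r\<close> means that \<open>a\<close> is ranked
  ahead of \<open>b\<close>.
\<close>

definition strict_rankings :: "'a set \<Rightarrow> 'a rel set" where
  "strict_rankings V = {r. r \<subseteq> V \<times> V \<and> strict_linear_order_on V r}"

definition first_ranked :: "'a set \<Rightarrow> 'a rel \<Rightarrow> 'a" where
  "first_ranked V r = (THE a. a \<in> V \<and> (\<forall>b\<in>V - {a}. (a, b) \<in> r))"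

definition majority_margin :: "'a rel pmf \<Rightarrow> 'a \<Rightarrow> 'a \<Rightarrow> real" where
  "majority_margin R a b =
     measure_pmf.prob R {r. (a, b) \<in> r} - measure_pmf.prob R {r. (b, a) \<in> r}"

definition maximal_lotteries :: "'a set \<Rightarrow> 'a rel pmf \<Rightarrow> 'a pmf set" where
  "maximal_lotteries V R =
     {\<mu>. set_pmf \<mu> \<subseteq> V \<and> (\<forall>b\<in>V. (\<Sum>a\<in>V. pmf \<mu> a * majority_margin R a b) \<ge> 0)}"

end

theory Submission
  imports Defs
begin

text \<open>
  Choose \<open>z\<close> uniformly, start independent walks from all vertices, and rank the vertices by the order in
  which their walks reach \<open>z\<close>, breaking ties along an enumeration of the vertices or its reverse with
  probability one half each. Since \<open>z\<close> itself is hit at time \<open>0\<close> and from any other vertex the hitting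
  time is positive, \<open>z\<close> is ranked first. For \<open>a \<noteq> b\<close> the probability that \<open>a\<close> is ahead of \<open>b\<close> is the
  average over \<open>z\<close> of \<open>q\<^sub>z(a, b)\<close>, that is \<open>U(a, b) / |V|\<close>. So the margin matrix is a positive multiple of
  the advantage matrix, and the two have the same optimal strategies.
\<close>

section \<open>Hitting times\<close>

lemma strict_mono_sum_pos:
  fixes e :: "nat \<Rightarrow> real"
  assumes "\<And>k. 0 < e k"
  shows "strict_mono (\<lambda>n. \<Sum>k<n. e k)"
  by (rule strict_monoI_Suc) (use assms in simp)

text \<open>Jump \<open>m\<close> happens after \<open>m + 1\<close> holding times, so by strict
  monotonicity exactly the jumps \<open>m < n\<close> are counted: at its own time a jump already
  counts.\<close>

lemma jump_count_partial_sum: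
  assumes "\<And>k. 0 < e k"
  shows "jump_count e (\<Sum>k<n. e k) = n"
proof -
  have "(\<Sum>k\<le>m. e k) \<le> (\<Sum>k<n. e k) \<longleftrightarrow> m < n" for m
    using strict_mono_less_eq[OF strict_mono_sum_pos[of e, OF assms], of "Suc m" n]
    by (simp only: lessThan_Suc_atMost Suc_le_eq)
  then show ?thesis by (simp add: jump_count_def)
qed

text \<open>A set with \<open>Suc n\<close> elements is not contained in \<open>{..<n}\<close>, so
  some counted jump has index at least \<open>n\<close>. If the count is \<open>0\<close>, the sum
  is empty; this includes infinite sets, whose \<open>card\<close> is \<open>0\<close>.\<close>

lemma partial_sum_jump_count_le:
  assumes "\<And>k. 0 < e k" "0 \<le> t"
  shows "(\<Sum>k<jump_count e t. e k) \<le> t"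
proof (cases "jump_count e t")
  case (Suc n)
  let ?A = "{m. (\<Sum>k\<le>m. e k) \<le> t}"
  have "\<not> ?A \<subseteq> {..<n}"
    using card_mono[of "{..<n}" ?A] Suc by (auto simp: jump_count_def)
  then obtain m where "m \<in> ?A" "n \<le> m" by (meson lessThan_iff not_less subsetI)
  moreover have "(\<Sum>k<Suc n. e k) \<le> (\<Sum>k<Suc m. e k)"
    using strict_mono_less_eq[OF strict_mono_sum_pos[of e, OF assms(1)]] \<open>n \<le> m\<close> by blast
  ultimately show ?thesis using Suc by (simp add: lessThan_Suc_atMost)
qed (use assms in simp)

text \<open>
  The formula also covers explosive paths: there \<^const>\<open>jump_count\<close> is the cardinality of an infinite
  set, that is \<open>0\<close>, after the explosion, so the walk is back at its start and no vertex is first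
  reached at such a time.
\<close>

lemma hitting_time_eq_INF:
  assumes pos: "\<And>k. 0 < fst \<omega> k"
  shows "hitting_time a z \<omega> =
    (INF n. if jump_chain a (snd \<omega>) n = z then ereal (\<Sum>k<n. fst \<omega> k) else \<infinity>)"
    (is "_ = (INF n. ?T n)")
proof (rule antisym)
  show "hitting_time a z \<omega> \<le> (INF n. ?T n)"
  proof (rule INF_greatest)
    fix n
    \<comment> \<open>The partial sum is a nonnegative time at which the walk sits at index
      \<open>n\<close> of its jump chain, so it is a candidate in the infimum.\<close>
    have "0 \<le> (\<Sum>k<n. fst \<omega> k)" by (intro sum_nonneg less_imp_le pos)
    then show "hitting_time a z \<omega> \<le> ?T n"
      by (auto simp: hitting_time_def walk_at_def jump_count_partial_sum[of "fst \<omega>", OF pos]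
          intro!: INF_lower)
  qed
  show "(INF n. ?T n) \<le> hitting_time a z \<omega>"
    unfolding hitting_time_def
  proof (rule INF_greatest)
    fix t assume "t \<in> {t. 0 \<le> t \<and> walk_at a \<omega> t = z}"
    then have "?T (jump_count (fst \<omega>) t) \<le> ereal t"
      using partial_sum_jump_count_le[of "fst \<omega>" t, OF pos] by (simp add: walk_at_def)
    then show "(INF n. ?T n) \<le> ereal t" by (rule INF_lower2[OF UNIV_I])
  qed
qed

lemma hitting_time_self:
  assumes "\<And>k. 0 < fst \<omega> k"
  shows "hitting_time a a \<omega> = 0"
proof (rule antisym)
  show "hitting_time a a \<omega> \<le> 0"
    unfolding hitting_time_eq_INF[of \<omega>, OF assms] by (rule INF_lower2[of 0]) auto
  show "0 \<le> hitting_time a a \<omega>"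
    by (auto simp: hitting_time_def intro!: INF_greatest)
qed

text \<open>Index \<open>0\<close> is not a visit to \<open>z\<close>, so every visit comes after
  the first holding time. This one positive bound for all \<open>n\<close> survives the
  infimum.\<close>

lemma hitting_time_pos:
  assumes pos: "\<And>k. 0 < fst \<omega> k" and "a \<noteq> z"
  shows "0 < hitting_time a z \<omega>"
proof -
  have "ereal (fst \<omega> 0) \<le> hitting_time a z \<omega>"
    unfolding hitting_time_eq_INF[of \<omega>, OF pos]
  proof (rule INF_greatest)
    fix n
    show "ereal (fst \<omega> 0) \<le> (if jump_chain a (snd \<omega>) n = z then ereal (\<Sum>k<n. fst \<omega> k) else \<infinity>)"
    proof (cases n)
      case (Suc m)
      have "fst \<omega> 0 \<le> (\<Sum>k<n. fst \<omega> k)"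
        using Suc by (intro member_le_sum) (auto intro: less_imp_le pos)
      then show ?thesis by simp
    qed (use \<open>a \<noteq> z\<close> in simp)
  qed
  then show ?thesis using pos[of 0] by (metis ereal_less(2) less_le_trans)
qed


section \<open>The walk space\<close>

lemma space_holding_time: "space holding_time = {0<..}"
  by (simp add: holding_time_def space_restrict_space)

text \<open>The exponential density vanishes on negative reals and \<open>{0}\<close> is a Lebesgue
  null set, so restricting to \<open>{0<..}\<close> loses no mass.\<close>

lemma prob_space_holding_time: "prob_space holding_time"
  unfolding holding_time_def
proof (rule prob_space_restrict_space)
  let ?D = "density lborel (exponential_density 1) :: real measure"
  interpret prob_space ?D by (rule prob_space_exponential_density) simp
  have "emeasure ?D {0<..} = emeasure ?D (space ?D)"
  proof (rule emeasure_eq_AE)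
    have "AE x in lborel. x \<noteq> (0 :: real)"
      by (rule AE_lborel_singleton)
    then show "AE x in ?D. (x \<in> {0<..}) = (x \<in> space ?D)"
      by (subst AE_density) (auto simp: exponential_density_def elim!: eventually_mono)
  qed auto
  then show "emeasure ?D {0<..} = 1" by (simp only: emeasure_space_1)
qed simp

lemma measurable_holding_time [measurable]: "(\<lambda>x. x) \<in> borel_measurable holding_time"
  by (auto simp: holding_time_def intro: measurable_restrict_space1)

lemma (in wf_digraph) targets_subset: "v \<in> verts G \<Longrightarrow> targets G v \<subseteq> verts G"
  by (auto simp: targets_def neighbours_def)

lemma targets_nonempty: "targets G v \<noteq> {}"
  by (auto simp: targets_def)

lemma (in fin_digraph) prob_space_walk_space: "prob_space (walk_space G)"
  unfolding walk_space_def
proof (intro prob_space_pair prob_space_PiM prob_space_holding_time prob_space_uniform_count_measure)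
  fix i assume "i \<in> (UNIV :: nat set) \<times> verts G"
  then show "finite (targets G (snd i))"
    by (auto intro: finite_subset[OF targets_subset])
qed (rule targets_nonempty)

lemma space_walk_space_pos: "\<omega> \<in> space (walk_space G) \<Longrightarrow> 0 < fst \<omega> k"
  by (auto simp: walk_space_def space_pair_measure space_PiM space_holding_time)

text \<open>The next state is a coordinate whose index depends on the current state. The current
  state has countably many values, so measurability of each fixed coordinate suffices; the codomain
  \<open>verts G\<close> keeps the index inside the product.\<close>

lemma (in fin_digraph) measurable_jump_chain:
  assumes "a \<in> verts G"
  shows "(\<lambda>\<omega>. jump_chain a (snd \<omega>) n) \<in> walk_space G \<rightarrow>\<^sub>M count_space (verts G)"
proof (induction n)
  case (Suc n)
  show ?case unfolding jump_chain.simps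
  proof (rule measurable_compose_countable'[where f = "\<lambda>v \<omega>. snd \<omega> (n, v)", OF _ Suc])
    fix v assume v: "v \<in> verts G"
    have "(\<lambda>\<omega>. snd \<omega> (n, v)) \<in> walk_space G \<rightarrow>\<^sub>M uniform_count_measure (targets G (snd (n, v)))"
      unfolding walk_space_def
      using v by (intro measurable_compose[OF measurable_snd] measurable_component_singleton) simp
    also have "walk_space G \<rightarrow>\<^sub>M uniform_count_measure (targets G (snd (n, v))) =
        walk_space G \<rightarrow>\<^sub>M count_space (targets G v)"
      by (rule measurable_cong_sets) (simp_all add: sets_uniform_count_measure)
    also have "\<dots> \<subseteq> walk_space G \<rightarrow>\<^sub>M count_space (verts G)"
    proof
      fix c assume "c \<in> walk_space G \<rightarrow>\<^sub>M count_space (targets G v)"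
      moreover have "(\<lambda>w. w) \<in> count_space (targets G v) \<rightarrow>\<^sub>M count_space (verts G)"
        using targets_subset[OF v] by auto
      ultimately show "c \<in> walk_space G \<rightarrow>\<^sub>M count_space (verts G)"
        by (rule measurable_compose)
    qed
    finally show "(\<lambda>\<omega>. snd \<omega> (n, v)) \<in> walk_space G \<rightarrow>\<^sub>M count_space (verts G)" .
  qed (simp add: countable_finite)
qed (use assms in simp)

text \<open>The infimum over uncountably many times is replaced by one over the jump indices, a
  countable infimum of measurable functions.\<close>

lemma (in fin_digraph) borel_measurable_hitting_time:
  assumes "a \<in> verts G"
  shows "hitting_time a z \<in> borel_measurable (walk_space G)"
proof -
  have [measurable]: "(\<lambda>\<omega>. fst \<omega> k) \<in> borel_measurable (walk_space G)" for k
    unfolding walk_space_def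
    by (intro measurable_compose[OF measurable_fst] measurable_compose[OF measurable_component_singleton]
        measurable_holding_time UNIV_I)
  have [measurable]: "Measurable.pred (walk_space G) (\<lambda>\<omega>. jump_chain a (snd \<omega>) n = z)" for n
    by (rule measurable_compose[OF measurable_jump_chain[OF assms]]) simp
  have "(\<lambda>\<omega>. INF n. if jump_chain a (snd \<omega>) n = z then ereal (\<Sum>k<n. fst \<omega> k) else \<infinity>)
    \<in> borel_measurable (walk_space G)"
    by measurable
  then show ?thesis
    by (rule measurable_cong[THEN iffD2, rotated])
      (rule hitting_time_eq_INF, rule space_walk_space_pos)
qed


section \<open>Independent copies\<close>

text \<open>Both measures agree on rectangles, where the left side is the measure of a cylinder over
  two coordinates. This lets a family of walks be compared two at a time.\<close>

lemma distr_PiM_pair: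
  assumes M: "\<And>i. prob_space (M i)" and ij: "i \<in> I" "j \<in> I" "i \<noteq> j"
  shows "distr (PiM I M) (M i \<Otimes>\<^sub>M M j) (\<lambda>x. (x i, x j)) = M i \<Otimes>\<^sub>M M j"
proof -
  interpret M: prob_space "M k" for k by (rule M)
  interpret product_prob_space M I ..
  have meas: "(\<lambda>x. (x i, x j)) \<in> PiM I M \<rightarrow>\<^sub>M M i \<Otimes>\<^sub>M M j" using ij by measurable
  show ?thesis
  proof (rule pair_measure_eqI[symmetric])
    fix A B assume AB: "A \<in> sets (M i)" "B \<in> sets (M j)"
    let ?X = "\<lambda>k. if k = i then A else B"
    have "(\<lambda>x. (x i, x j)) -` (A \<times> B) \<inter> space (PiM I M) = {x \<in> space (PiM I M). \<forall>k\<in>{i, j}. x k \<in> ?X k}"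
      using ij by auto
    then have "emeasure (distr (PiM I M) (M i \<Otimes>\<^sub>M M j) (\<lambda>x. (x i, x j))) (A \<times> B) =
      emeasure (PiM I M) {x \<in> space (PiM I M). \<forall>k\<in>{i, j}. x k \<in> ?X k}"
      using AB by (simp add: emeasure_distr[OF meas])
    also have "\<dots> = (\<Prod>k\<in>{i, j}. emeasure (M k) (?X k))"
      by (rule emeasure_PiM_Collect) (use ij AB in auto)
    finally show "emeasure (M i) A * emeasure (M j) B =
      emeasure (distr (PiM I M) (M i \<Otimes>\<^sub>M M j) (\<lambda>x. (x i, x j))) (A \<times> B)"
      using ij by simp
  qed (simp_all add: M.sigma_finite_measure_axioms)
qed

text \<open>A probability measure on the discrete sigma-algebra comes from a pmf once almost every
  point has positive mass. Here the values of mass zero are countably many, so together they are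
  avoided almost surely.\<close>

lemma (in prob_space) ex_pmf_distr:
  assumes f [measurable]: "f \<in> M \<rightarrow>\<^sub>M count_space UNIV" and "countable (f ` space M)"
  shows "\<exists>p. measure_pmf p = distr M (count_space UNIV) f"
proof -
  let ?D = "distr M (count_space UNIV) f"
  interpret D: prob_space ?D by (rule prob_space_distr) fact
  have "AE x in M. measure ?D {y} = 0 \<longrightarrow> f x \<noteq> y" if "y \<in> f ` space M" for y
  proof (cases "measure ?D {y} = 0")
    case True
    then have "prob {x \<in> space M. f x = y} = 0"
      by (simp add: measure_distr vimage_def Int_def conj_commute)
    then show ?thesis by (subst (asm) prob_eq_0) (auto simp: AE_conj_iff)
  qed simp
  then have "AE x in M. \<forall>y\<in>f ` space M. measure ?D {y} = 0 \<longrightarrow> f x \<noteq> y"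
    by (subst AE_ball_countable) (use assms in auto)
  then have "AE x in M. measure ?D {f x} \<noteq> 0"
    by (rule AE_mp) (auto intro!: AE_I2)
  then have "AE y in ?D. measure ?D {y} \<noteq> 0" by (subst AE_distr_iff) auto
  then show ?thesis
    by (intro exI[of _ "Abs_pmf ?D"]) (simp add: Abs_pmf_inverse D.prob_space_axioms)
qed


section \<open>Ranking by arrival\<close>

text \<open>Lexicographic order by arrival time \<open>h\<close>, then by tie-break
  \<open>g\<close>. Integer values of \<open>g\<close> allow a tie-break to be reversed by
  negation.\<close>

definition arrival_ranking :: "'a set \<Rightarrow> ('a \<Rightarrow> int) \<Rightarrow> ('a \<Rightarrow> ereal) \<Rightarrow> 'a rel" where
  "arrival_ranking V g h = {(a, b) \<in> V \<times> V. h a < h b \<or> h a = h b \<and> g a < g b}"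

lemma arrival_ranking_in_strict_rankings:
  assumes "inj_on g V"
  shows "arrival_ranking V g h \<in> strict_rankings V"
proof -
  have "trans (arrival_ranking V g h)"
    by (rule transI) (auto simp: arrival_ranking_def dest: less_trans)
  moreover have "irrefl (arrival_ranking V g h)"
    by (auto simp: irrefl_def arrival_ranking_def)
  moreover have "total_on V (arrival_ranking V g h)"
    using assms by (auto simp: total_on_def arrival_ranking_def inj_on_def)
      (metis linorder_neqE)+
  ultimately show ?thesis
    by (auto simp: strict_rankings_def strict_linear_order_on_def arrival_ranking_def)
qed

lemma first_ranked_arrival_ranking:
  assumes "z \<in> V" "\<And>b. b \<in> V \<Longrightarrow> b \<noteq> z \<Longrightarrow> h z < h b"
  shows "first_ranked V (arrival_ranking V g h) = z"
  unfolding first_ranked_def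
proof (rule the_equality)
  show "z \<in> V \<and> (\<forall>b\<in>V - {z}. (z, b) \<in> arrival_ranking V g h)"
    using assms by (auto simp: arrival_ranking_def)
  fix a assume a: "a \<in> V \<and> (\<forall>b\<in>V - {a}. (a, b) \<in> arrival_ranking V g h)"
  show "a = z"
  proof (rule ccontr)
    assume "a \<noteq> z"
    then have "(a, z) \<in> arrival_ranking V g h" using a assms(1) by blast
    then have "h a \<le> h z" by (auto simp: arrival_ranking_def)
    then show False using assms(2)[of a] a \<open>a \<noteq> z\<close> by auto
  qed
qed

section \<open>Margins and mixtures of random rankings\<close>

lemma strict_rankings_asym:
  assumes "r \<in> strict_rankings V" "a \<in> V" "b \<in> V" "a \<noteq> b"
  shows "(b, a) \<in> r \<longleftrightarrow> (a, b) \<notin> r"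
  using assms unfolding strict_rankings_def strict_linear_order_on_def
  by (auto simp: total_on_def irrefl_def dest: transD)

text \<open>On strict rankings of distinct vertices the two events are complementary, so the margin
  is \<open>p - (1 - p)\<close>.\<close>

lemma majority_margin_eq:
  assumes "set_pmf R \<subseteq> strict_rankings V" "a \<in> V" "b \<in> V" "a \<noteq> b"
  shows "majority_margin R a b = 2 * measure_pmf.prob R {r. (a, b) \<in> r} - 1"
proof -
  have "measure_pmf.prob R {r. (b, a) \<in> r} = measure_pmf.prob R (- {r. (a, b) \<in> r})"
    using strict_rankings_asym[OF _ assms(2-4)] assms(1)
    by (intro measure_pmf.finite_measure_eq_AE) (auto simp: AE_measure_pmf_iff)
  then show ?thesis
    by (simp add: majority_margin_def measure_pmf.prob_compl[of "{r. (a, b) \<in> r}" R, simplified] Compl_eq_Diff_UNIV)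
qed

lemma majority_margin_self [simp]: "majority_margin R a a = 0"
  by (simp add: majority_margin_def)

lemma measure_bind_pmf_of_set:
  assumes "finite S" "S \<noteq> {}"
  shows "measure_pmf.prob (pmf_of_set S \<bind> f) A = (\<Sum>x\<in>S. measure_pmf.prob (f x) A) / card S"
proof -
  have "measure_pmf.prob (pmf_of_set S \<bind> f) A = (\<integral>x. measure_pmf.prob (f x) A \<partial>measure_pmf (pmf_of_set S))"
    unfolding measure_pmf_bind
    by (rule measure_pmf.measure_bind[where N = "count_space UNIV"]) (auto simp: measure_subprob)
  then show ?thesis using assms by (simp add: integral_pmf_of_set)
qed

section \<open>Comparing arrivals of independent walks\<close>

lemma (in fin_digraph) hitting_time_measurable_fst_snd:
  assumes "a \<in> verts G" "b \<in> verts G"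
  shows "(\<lambda>\<omega>. hitting_time a z (fst \<omega>)) \<in> borel_measurable (walk_space G \<Otimes>\<^sub>M walk_space G)"
    and "(\<lambda>\<omega>. hitting_time b z (snd \<omega>)) \<in> borel_measurable (walk_space G \<Otimes>\<^sub>M walk_space G)"
  by (auto intro: measurable_compose[OF measurable_fst] measurable_compose[OF measurable_snd]
      borel_measurable_hitting_time assms)

text \<open>Swapping two walks with the same start preserves their joint law, so either is strictly
  first with equal probability; ties are split evenly. Hence the advantage matrix has zero diagonal,
  as a margin matrix does.\<close>

lemma (in fin_digraph) first_passage_prob_self:
  assumes "a \<in> verts G"
  shows "first_passage_prob G z a a = 1 / 2"
proof -
  let ?W = "walk_space G"
  interpret W: prob_space ?W by (rule prob_space_walk_space)
  interpret WW: pair_prob_space ?W ?W ..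
  note [measurable] = hitting_time_measurable_fst_snd[OF assms assms]
  let ?h = "\<lambda>\<omega>. hitting_time a z (fst \<omega>)" and ?h' = "\<lambda>\<omega>. hitting_time a z (snd \<omega>)"
  let ?L = "{\<omega> \<in> space (?W \<Otimes>\<^sub>M ?W). ?h \<omega> < ?h' \<omega>}"
  let ?E = "{\<omega> \<in> space (?W \<Otimes>\<^sub>M ?W). ?h \<omega> = ?h' \<omega>}"
  let ?R = "{\<omega> \<in> space (?W \<Otimes>\<^sub>M ?W). ?h' \<omega> < ?h \<omega>}"
  have "WW.prob ?L = measure (distr (?W \<Otimes>\<^sub>M ?W) (?W \<Otimes>\<^sub>M ?W) (\<lambda>(x, y). (y, x))) ?L"
    by (simp only: WW.distr_pair_swap[symmetric])
  also have "\<dots> = WW.prob ?R"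
    by (subst measure_distr)
      (auto intro!: arg_cong[where f = WW.prob] simp: space_pair_measure)
  finally have sym: "WW.prob ?L = WW.prob ?R" .
  have "WW.prob ?L + WW.prob ?E + WW.prob ?R = WW.prob (?L \<union> ?E \<union> ?R)"
    by (subst WW.finite_measure_Union; (subst WW.finite_measure_Union)?) auto
  also have "?L \<union> ?E \<union> ?R = space (?W \<Otimes>\<^sub>M ?W)" by auto
  finally have "WW.prob ?L + WW.prob ?E + WW.prob ?R = 1" by (simp only: WW.prob_space)
  then show ?thesis using sym unfolding first_passage_prob_def by simp
qed

text \<open>\<open>Q\<close> is the law of the arrival ranking for one fixed target and one fixed
  tie-break. The whole probability of a tie goes to the vertex with smaller \<open>g\<close>; it is
  halved only by mixing two tie-breaks later.\<close>

lemma (in fin_digraph) ex_arrival_pmf: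
  fixes g :: "'a \<Rightarrow> int"
  assumes "inj_on g (verts G)" and z: "z \<in> verts G"
  defines "\<Omega> \<equiv> \<Pi>\<^sub>M a\<in>verts G. walk_space G"
  shows "\<exists>Q. set_pmf Q \<subseteq> strict_rankings (verts G) \<and>
    map_pmf (first_ranked (verts G)) Q = return_pmf z \<and>
    (\<forall>a\<in>verts G. \<forall>b\<in>verts G. a \<noteq> b \<longrightarrow> measure_pmf.prob Q {r. (a, b) \<in> r} =
      \<P>(\<omega> in walk_space G \<Otimes>\<^sub>M walk_space G. hitting_time a z (fst \<omega>) < hitting_time b z (snd \<omega>)) +
      (if g a < g b
       then \<P>(\<omega> in walk_space G \<Otimes>\<^sub>M walk_space G. hitting_time a z (fst \<omega>) = hitting_time b z (snd \<omega>))
       else 0))"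
proof -
  let ?W = "walk_space G"
  let ?r = "\<lambda>\<omega>. arrival_ranking (verts G) g (\<lambda>a. hitting_time a z (\<omega> a))"
  interpret W: prob_space ?W by (rule prob_space_walk_space)
  interpret WW: pair_prob_space ?W ?W ..
  interpret \<Omega>: prob_space \<Omega> unfolding \<Omega>_def by (intro prob_space_PiM prob_space_walk_space)
  have [measurable]: "(\<lambda>\<omega>. hitting_time a z (\<omega> a)) \<in> borel_measurable \<Omega>" if "a \<in> verts G" for a
    unfolding \<Omega>_def using that
    by (intro measurable_compose[OF measurable_component_singleton] borel_measurable_hitting_time)
  have [measurable]: "Measurable.pred \<Omega> (\<lambda>\<omega>. hitting_time a z (\<omega> a) = hitting_time b z (\<omega> b))"
    if "a \<in> verts G" "b \<in> verts G" for a b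
    unfolding pred_def using that by (intro borel_measurable_eq) measurable
  have range: "?r ` space \<Omega> \<subseteq> Pow (verts G \<times> verts G)"
    by (auto simp: arrival_ranking_def)
  have meas: "?r \<in> \<Omega> \<rightarrow>\<^sub>M count_space UNIV"
  proof -
    \<comment> \<open>Only finitely many rankings can occur, so preimages of single relations
      suffice, and each is a finite conjunction of comparisons of hitting times.\<close>
    have "?r -` {r} \<inter> space \<Omega> \<in> sets \<Omega>" if "r \<subseteq> verts G \<times> verts G" for r
    proof -
      have "?r -` {r} \<inter> space \<Omega> = {\<omega> \<in> space \<Omega>. \<forall>a\<in>verts G. \<forall>b\<in>verts G.
        (hitting_time a z (\<omega> a) < hitting_time b z (\<omega> b) \<or>
         hitting_time a z (\<omega> a) = hitting_time b z (\<omega> b) \<and> g a < g b) \<longleftrightarrow> (a, b) \<in> r}"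
        using that by (auto simp: arrival_ranking_def set_eq_iff)
      also have "\<dots> \<in> sets \<Omega>"
      proof (intro sets.sets_Collect_finite_All finite_verts)
        fix a b assume [measurable]: "a \<in> verts G" "b \<in> verts G"
        show "{\<omega> \<in> space \<Omega>. (hitting_time a z (\<omega> a) < hitting_time b z (\<omega> b) \<or>
            hitting_time a z (\<omega> a) = hitting_time b z (\<omega> b) \<and> g a < g b) \<longleftrightarrow> (a, b) \<in> r} \<in> sets \<Omega>"
          by (cases "(a, b) \<in> r"; cases "g a < g b") (simp_all only: simp_thms, measurable)
      qed
      finally show ?thesis .
    qed
    then have "?r \<in> \<Omega> \<rightarrow>\<^sub>M count_space (Pow (verts G \<times> verts G))"
      using range by (subst measurable_count_space_eq2) auto
    then show ?thesis by (rule measurable_compose) simp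
  qed
  have "countable (?r ` space \<Omega>)"
    by (rule countable_finite[OF finite_subset[OF range]]) simp
  then obtain Q where Q: "measure_pmf Q = distr \<Omega> (count_space UNIV) ?r"
    using \<Omega>.ex_pmf_distr[OF meas] by blast
  \<comment> \<open>Every ranking in the support comes from an actual sample point, so facts valid
    at all sample points hold on the whole support.\<close>
  have supp: "set_pmf Q \<subseteq> ?r ` space \<Omega>"
  proof -
    have "AE r in measure_pmf Q. r \<in> ?r ` space \<Omega>"
      unfolding Q by (subst AE_distr_iff[OF meas]) auto
    then show ?thesis by (auto simp: AE_measure_pmf_iff)
  qed
  have first: "first_ranked (verts G) (?r \<omega>) = z" if "\<omega> \<in> space \<Omega>" for \<omega>
  proof (rule first_ranked_arrival_ranking[OF z])
    have pos: "0 < fst (\<omega> a) k" if "a \<in> verts G" for a k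
      using \<open>\<omega> \<in> space \<Omega>\<close> that by (intro space_walk_space_pos[of _ G]) (auto simp: \<Omega>_def space_PiM)
    fix b assume "b \<in> verts G" "b \<noteq> z"
    then show "hitting_time z z (\<omega> z) < hitting_time b z (\<omega> b)"
      using hitting_time_self[of "\<omega> z", OF pos[OF z]] hitting_time_pos[of "\<omega> b" b z, OF pos] by simp
  qed
  have "map_pmf (first_ranked (verts G)) Q = map_pmf (\<lambda>_. z) Q"
    using supp first by (intro map_pmf_cong) auto
  moreover have "measure_pmf.prob Q {r. (a, b) \<in> r} =
      \<P>(\<omega> in ?W \<Otimes>\<^sub>M ?W. hitting_time a z (fst \<omega>) < hitting_time b z (snd \<omega>)) +
      (if g a < g b then \<P>(\<omega> in ?W \<Otimes>\<^sub>M ?W. hitting_time a z (fst \<omega>) = hitting_time b z (snd \<omega>)) else 0)"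
    if ab: "a \<in> verts G" "b \<in> verts G" "a \<noteq> b" for a b
  proof -
    note [measurable] = hitting_time_measurable_fst_snd[OF ab(1,2)]
    have pair [measurable]: "(\<lambda>\<omega>. (\<omega> a, \<omega> b)) \<in> \<Omega> \<rightarrow>\<^sub>M ?W \<Otimes>\<^sub>M ?W"
      using ab unfolding \<Omega>_def by measurable
    \<comment> \<open>As \<open>a\<close> and \<open>b\<close> are distinct, their walks are
      different coordinates and have the joint law used in
      \<open>first_passage_prob\<close>.\<close>
    have D: "distr \<Omega> (?W \<Otimes>\<^sub>M ?W) (\<lambda>\<omega>. (\<omega> a, \<omega> b)) = ?W \<Otimes>\<^sub>M ?W"
      unfolding \<Omega>_def by (rule distr_PiM_pair) (use ab W.prob_space_axioms in auto)
    let ?P = "\<lambda>\<omega>. hitting_time a z (fst \<omega>) < hitting_time b z (snd \<omega>) \<or>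
      hitting_time a z (fst \<omega>) = hitting_time b z (snd \<omega>) \<and> g a < g b"
    have "measure_pmf.prob Q {r. (a, b) \<in> r} = \<Omega>.prob (?r -` {r. (a, b) \<in> r} \<inter> space \<Omega>)"
      unfolding Q by (rule measure_distr[OF meas]) simp
    also have "?r -` {r. (a, b) \<in> r} \<inter> space \<Omega> =
      (\<lambda>\<omega>. (\<omega> a, \<omega> b)) -` {\<omega> \<in> space (?W \<Otimes>\<^sub>M ?W). ?P \<omega>} \<inter> space \<Omega>"
      using ab measurable_space[OF pair] by (auto simp: arrival_ranking_def)
    also have "\<Omega>.prob \<dots> = measure (distr \<Omega> (?W \<Otimes>\<^sub>M ?W) (\<lambda>\<omega>. (\<omega> a, \<omega> b))) {\<omega> \<in> space (?W \<Otimes>\<^sub>M ?W). ?P \<omega>}"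
      by (rule measure_distr[OF pair, symmetric]) measurable
    also have "\<dots> = \<P>(\<omega> in ?W \<Otimes>\<^sub>M ?W. ?P \<omega>)" by (simp only: D)
    also have "{\<omega> \<in> space (?W \<Otimes>\<^sub>M ?W). ?P \<omega>} =
      {\<omega> \<in> space (?W \<Otimes>\<^sub>M ?W). hitting_time a z (fst \<omega>) < hitting_time b z (snd \<omega>)} \<union>
      (if g a < g b then {\<omega> \<in> space (?W \<Otimes>\<^sub>M ?W). hitting_time a z (fst \<omega>) = hitting_time b z (snd \<omega>)} else {})"
      by auto
    also have "WW.prob \<dots> = \<P>(\<omega> in ?W \<Otimes>\<^sub>M ?W. hitting_time a z (fst \<omega>) < hitting_time b z (snd \<omega>)) +
      (if g a < g b then \<P>(\<omega> in ?W \<Otimes>\<^sub>M ?W. hitting_time a z (fst \<omega>) = hitting_time b z (snd \<omega>)) else 0)"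
      by (subst WW.finite_measure_Union) auto
    finally show ?thesis .
  qed
  moreover have "set_pmf Q \<subseteq> strict_rankings (verts G)"
    using supp arrival_ranking_in_strict_rankings[OF assms(1)] by blast
  ultimately show ?thesis by (intro exI[of _ Q]) simp
qed

section \<open>The mixture over targets and tie-breaks\<close>

theorem proposition2p1:
  fixes G :: "('a, 'b) pre_digraph"
  assumes "graph G" and "Digraph_Component.connected G"
  shows "\<exists>R :: 'a rel pmf.
           set_pmf R \<subseteq> strict_rankings (verts G) \<and>
           map_pmf (first_ranked (verts G)) R = pmf_of_set (verts G) \<and>
           (\<forall>a\<in>verts G. \<forall>b\<in>verts G.
              majority_margin R a b = 2 * advantage G a b / real (card (verts G))) \<and>
           optimal_strategies G = maximal_lotteries (verts G) R"
proof -
  interpret graph G by fact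
  let ?V = "verts G"
  have ne: "?V \<noteq> {}"
    using assms(2) by (simp add: Digraph_Component.connected_def strongly_connected_def)
  then have card: "0 < real (card ?V)" by (simp add: card_gt_0_iff)
  obtain f :: "'a \<Rightarrow> nat" where f: "inj_on f ?V"
    using finite_imp_inj_to_nat_seg[OF finite_verts] by blast
  \<comment> \<open>The enumeration \<open>f\<close> and its reverse: any two distinct vertices are
    ordered oppositely by \<open>g True\<close> and \<open>g False\<close>.\<close>
  define g where "g s a = (if s then int (f a) else - int (f a))" for s a
  have inj: "inj_on (g s) ?V" for s using f by (auto simp: g_def inj_on_def)
  define arrival where "arrival s z Q \<longleftrightarrow> set_pmf Q \<subseteq> strict_rankings ?V \<and>
    map_pmf (first_ranked ?V) Q = return_pmf z \<and>
    (\<forall>a\<in>?V. \<forall>b\<in>?V. a \<noteq> b \<longrightarrow> measure_pmf.prob Q {r. (a, b) \<in> r} =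
      \<P>(\<omega> in walk_space G \<Otimes>\<^sub>M walk_space G. hitting_time a z (fst \<omega>) < hitting_time b z (snd \<omega>)) +
      (if g s a < g s b
       then \<P>(\<omega> in walk_space G \<Otimes>\<^sub>M walk_space G. hitting_time a z (fst \<omega>) = hitting_time b z (snd \<omega>))
       else 0))" for s z Q
  define Q where "Q s z = (SOME Q. arrival s z Q)" for s z
  have Q: "arrival s z (Q s z)" if "z \<in> ?V" for s z
    unfolding Q_def by (rule someI_ex) (use ex_arrival_pmf[OF inj that] in \<open>simp add: arrival_def\<close>)
  \<comment> \<open>The target \<open>z\<close> is drawn uniformly, then a fair coin
    \<open>s\<close> selects the tie-break.\<close>
  define R where "R = pmf_of_set ?V \<bind> (\<lambda>z. pmf_of_set UNIV \<bind> (\<lambda>s. Q s z))"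
  have R: "set_pmf R \<subseteq> strict_rankings ?V"
    using Q ne by (auto simp: R_def arrival_def set_pmf_of_set) blast
  \<comment> \<open>Each \<open>Q s z\<close> ranks \<open>z\<close> first with certainty, so the
    first-ranked vertex is the uniform target itself.\<close>
  have "map_pmf (first_ranked ?V) R = pmf_of_set ?V \<bind> return_pmf"
    unfolding R_def map_bind_pmf using Q ne by (intro bind_pmf_cong) (auto simp: arrival_def set_pmf_of_set)
  then have first: "map_pmf (first_ranked ?V) R = pmf_of_set ?V"
    by (simp add: bind_return_pmf')
  have margin: "majority_margin R a b = 2 * advantage G a b / card ?V" if ab: "a \<in> ?V" "b \<in> ?V" for a b
  proof (cases "a = b")
    case True
    then show ?thesis
      using ab by (simp add: advantage_def payoff_def first_passage_prob_self)
  next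
    case False
    have "measure_pmf.prob (pmf_of_set UNIV \<bind> (\<lambda>s. Q s z)) {r. (a, b) \<in> r} = first_passage_prob G z a b"
      if "z \<in> ?V" for z
    proof -
      \<comment> \<open>Exactly one of the two tie-breaks favours \<open>a\<close>, so the average
        over \<open>s\<close> contains half the probability of a tie.\<close>
      have "f a \<noteq> f b" using f ab False by (auto simp: inj_on_def)
      then show ?thesis
        using Q[OF that] ab False
        by (auto simp: arrival_def measure_bind_pmf_of_set UNIV_bool g_def first_passage_prob_def)
    qed
    then have "measure_pmf.prob R {r. (a, b) \<in> r} = payoff G a b / card ?V"
      using ne by (simp add: R_def measure_bind_pmf_of_set payoff_def)
    then have "majority_margin R a b = 2 * (payoff G a b / card ?V) - 1"
      by (simp add: majority_margin_eq[OF R ab False])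
    also have "\<dots> = 2 * (payoff G a b - card ?V / 2) / card ?V"
      using ne by (simp add: diff_divide_distrib right_diff_distrib)
    finally show ?thesis by (simp only: advantage_def)
  qed
  \<comment> \<open>The factor \<open>2 / card ?V\<close> is positive, so the inequalities defining
    the two sets have the same solutions.\<close>
  have "(\<Sum>a\<in>?V. pmf \<mu> a * majority_margin R a b) = 2 / card ?V * (\<Sum>a\<in>?V. pmf \<mu> a * advantage G a b)"
    if "b \<in> ?V" for \<mu> b
    using that by (auto simp: margin sum_distrib_left intro!: sum.cong)
  then have "optimal_strategies G = maximal_lotteries ?V R"
    using card by (auto simp: optimal_strategies_def maximal_lotteries_def zero_le_mult_iff zero_le_divide_iff)
  with R first margin show ?thesis by blast
qed

end
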